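(* Let $\mathcal H$ be a complex Hilbert space and let $T$ be a bounded operator on $\mathcal H$ which is a $2$-isometry. Assume further that $1$ is not an eigenvalue of $T$, and that there exists $w\ge0$ such that $$\|Tx\|^2-\|x\|^2\le w\|(T-I)x\|^2,\quad x\in\mathcal H.$$ Then $T$ is the cogenerator of a $C_0$-semigroup $(T_t)_{t\ge0}$ on $\mathcal H$, which is $2$-isometric, and quasicontractive with parameter $w$.
   Context: A bounded operator $T$ is a $2$-isometry if $\|T^2x\|^2-2\|Tx\|^2+\|x\|^2=0$ for all $x\in\mathcal H$. A $C_0$-semigroup is $2$-isometric if each of its members is a $2$-isometry. If $A$ is the generator of a $C_0$-semigroup $(T_t)_{t\ge0}$ and $1$ belongs to the resolvent set of $A$, the cogenerator of the semigroup is the bounded operator $(A+I)(A-I)^{-1}$. A $C_0$-semigroup $(T_t)_{t\ge0}$ is quasicontractive with parameter $w$ if $\|T_t\|\le e^{wt}$ for all $t\ge0$. *)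

theory Defs
  imports "HOL-Analysis.Analysis"
begin

(* Complex inner product spaces are built on top of the library's real_inner, so that norm,
   topology and onorm are the library's.  The underlying real inner product is forced to be
   the real part of the complex one; hence norm x = sqrt (Re (cinner x x)), and positive
   definiteness of cinner is inherited from real_inner. *)
class complex_inner = real_inner +
  fixes scaleC :: "complex \<Rightarrow> 'a \<Rightarrow> 'a"  (infixr \<open>*\<^sub>C\<close> 75)
    and cinner :: "'a \<Rightarrow> 'a \<Rightarrow> complex"
  assumes scaleC_add_right: "c *\<^sub>C (x + y) = c *\<^sub>C x + c *\<^sub>C y"
    and scaleC_add_left: "(c + d) *\<^sub>C x = c *\<^sub>C x + d *\<^sub>C x"
    and scaleC_scaleC: "c *\<^sub>C d *\<^sub>C x = (c * d) *\<^sub>C x"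
    and scaleR_eq_scaleC: "r *\<^sub>R x = complex_of_real r *\<^sub>C x"
    and cinner_commute: "cinner x y = cnj (cinner y x)"
    and cinner_add_left: "cinner (x + y) z = cinner x z + cinner y z"
    and cinner_scaleC_left: "cinner (c *\<^sub>C x) y = c * cinner x y"
    and inner_eq_Re_cinner: "inner x y = Re (cinner x y)"

class chilbert_space = complex_inner + complete_space

instantiation complex :: chilbert_space
begin

definition scaleC_complex :: "complex \<Rightarrow> complex \<Rightarrow> complex"
  where "scaleC_complex c x = c * x"

definition cinner_complex :: "complex \<Rightarrow> complex \<Rightarrow> complex"
  where "cinner_complex x y = x * cnj y"

instance
  by standard
    (auto simp: scaleC_complex_def cinner_complex_def inner_complex_def algebra_simps
      scaleR_conv_of_real)

end

definition bounded_clinear :: "('a::complex_inner \<Rightarrow> 'a) \<Rightarrow> bool"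
  where "bounded_clinear T \<longleftrightarrow> bounded_linear T \<and> (\<forall>c x. T (c *\<^sub>C x) = c *\<^sub>C T x)"

definition eigenvalue :: "('a::complex_inner \<Rightarrow> 'a) \<Rightarrow> complex \<Rightarrow> bool"
  where "eigenvalue T c \<longleftrightarrow> (\<exists>x. x \<noteq> 0 \<and> T x = c *\<^sub>C x)"

definition two_isometry :: "('a::complex_inner \<Rightarrow> 'a) \<Rightarrow> bool"
  where "two_isometry T \<longleftrightarrow> bounded_clinear T \<and>
    (\<forall>x. (norm (T (T x)))\<^sup>2 - 2 * (norm (T x))\<^sup>2 + (norm x)\<^sup>2 = 0)"

(* A semigroup is a function on all of real; its values at negative times are irrelevant. *)
definition C0_semigroup :: "(real \<Rightarrow> 'a::complex_inner \<Rightarrow> 'a) \<Rightarrow> bool"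
  where "C0_semigroup S \<longleftrightarrow>
    (\<forall>t\<ge>0. bounded_clinear (S t)) \<and>
    S 0 = id \<and>
    (\<forall>s\<ge>0. \<forall>t\<ge>0. S (s + t) = S s \<circ> S t) \<and>
    (\<forall>x. ((\<lambda>t. S t x) \<longlongrightarrow> x) (at_right 0))"

(* An unbounded operator is a pair of a domain and a function; the function is unspecified
   outside the domain. *)
definition generator_dom :: "(real \<Rightarrow> 'a::complex_inner \<Rightarrow> 'a) \<Rightarrow> 'a set"
  where "generator_dom S = {x. \<exists>y. ((\<lambda>t. (S t x - x) /\<^sub>R t) \<longlongrightarrow> y) (at_right 0)}"

definition generator :: "(real \<Rightarrow> 'a::complex_inner \<Rightarrow> 'a) \<Rightarrow> 'a \<Rightarrow> 'a"
  where "generator S x = Lim (at_right 0) (\<lambda>t. (S t x - x) /\<^sub>R t)"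

definition resolvent_set :: "'a::complex_inner set \<Rightarrow> ('a \<Rightarrow> 'a) \<Rightarrow> complex set"
  where "resolvent_set D A = {c.
    bij_betw (\<lambda>x. A x - c *\<^sub>C x) D UNIV \<and>
    bounded_clinear (inv_into D (\<lambda>x. A x - c *\<^sub>C x))}"

(* (A + I) (A - I)^{-1} for the generator A of S. *)
definition cogenerator :: "(real \<Rightarrow> 'a::complex_inner \<Rightarrow> 'a) \<Rightarrow> 'a \<Rightarrow> 'a"
  where "cogenerator S =
    (\<lambda>x. generator S x + x) \<circ> inv_into (generator_dom S) (\<lambda>x. generator S x - x)"

definition is_cogenerator :: "('a::complex_inner \<Rightarrow> 'a) \<Rightarrow> (real \<Rightarrow> 'a \<Rightarrow> 'a) \<Rightarrow> bool"
  where "is_cogenerator T S \<longleftrightarrow>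
    1 \<in> resolvent_set (generator_dom S) (generator S) \<and> T = cogenerator S"

definition two_isometric_semigroup :: "(real \<Rightarrow> 'a::complex_inner \<Rightarrow> 'a) \<Rightarrow> bool"
  where "two_isometric_semigroup S \<longleftrightarrow> C0_semigroup S \<and> (\<forall>t\<ge>0. two_isometry (S t))"

definition quasicontractive :: "real \<Rightarrow> (real \<Rightarrow> 'a::complex_inner \<Rightarrow> 'a) \<Rightarrow> bool"
  where "quasicontractive w S \<longleftrightarrow> C0_semigroup S \<and> (\<forall>t\<ge>0. onorm (S t) \<le> exp (w * t))"

end

(*
  The operator A = (T + I)(T - I)^{-1} with domain ran (T - I) satisfies
  Re <A y, y> = |T v|^2 - |v|^2 <= w |y|^2 for y = (T - I) v.  Since |T^n x|^2 is affine in n, the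
  spectral radius of T is at most 1, which makes (A - w) - mu onto for all mu > 0; a Lumer-Phillips
  argument (Yosida approximation, with Kato's estimate instead of commutation) then yields the
  semigroup.  For x in the dense set ran (T - I)^2 = dom A^2 the second derivative of |S_t x|^2
  vanishes because T is a 2-isometry, so |S_t x|^2 is affine in t, and S_t is a 2-isometry.
*)

theory Submission
  imports Defs
begin

section \<open>Exponentials of bounded operators\<close>

text \<open>The assumption on the eigenvalue makes \<open>T - I\<close> injective, so that
  \<open>A\<close> is well defined. That the range of \<open>T - I\<close> is dense comes out of
  maximal dissipativity instead, and density of the range of \<open>(T - I)^2\<close> then follows
  by continuity. The generation argument works with the real inner product alone, so complex
  linearity has to be recovered: whatever commutes with \<open>T\<close> commutes with
  \<open>A\<close>, with its Yosida approximations and with their limit. For complex scalars this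
  gives complex linearity; for \<open>T\<close> itself it turns the vanishing of the second
  derivative at time \<open>s\<close> into the 2-isometry identity of \<open>T\<close> at a single
  vector. One inequality, the mean value theorem for \<open>|u|^2\<close>, carries contractivity and
  the semigroup law of the exponentials as well as Kato's estimate. The construction shows at first
  only that the generator extends \<open>A\<close>. As the cogenerator is defined through the
  generator and its domain, equality of the domains requires an argument of its own.\<close>

lemma has_vector_derivative_sequence:
  fixes f :: "nat \<Rightarrow> real \<Rightarrow> 'b::banach"
  assumes "convex S"
    and der: "\<And>n x. x \<in> S \<Longrightarrow> (f n has_vector_derivative f' n x) (at x within S)"
    and lim: "uniform_limit S f' g' sequentially"
    and "x0 \<in> S" "(\<lambda>n. f n x0) \<longlonglongrightarrow> l"
  shows "\<exists>g. \<forall>x\<in>S. (\<lambda>n. f n x) \<longlonglongrightarrow> g x \<and> (g has_vector_derivative g' x) (at x within S)"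
  unfolding has_vector_derivative_def
proof (rule has_derivative_sequence[where f' = "\<lambda>n x h. h *\<^sub>R f' n x"])
  fix e :: real assume "e > 0"
  with lim have "\<forall>\<^sub>F n in sequentially. \<forall>x\<in>S. dist (f' n x) (g' x) < e"
    unfolding uniform_limit_iff by blast
  then show "\<forall>\<^sub>F n in sequentially. \<forall>x\<in>S. \<forall>h. norm (h *\<^sub>R f' n x - h *\<^sub>R g' x) \<le> e * norm h"
  proof eventually_elim
    case (elim n)
    show ?case
    proof (intro ballI allI)
      fix x h assume "x \<in> S"
      with elim have "\<bar>h\<bar> * norm (f' n x - g' x) \<le> \<bar>h\<bar> * e"
        by (intro mult_left_mono) (auto simp: dist_norm less_imp_le)
      then show "norm (h *\<^sub>R f' n x - h *\<^sub>R g' x) \<le> e * norm h"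
        by (simp flip: scaleR_diff_right add: mult.commute)
    qed
  qed
qed (use assms in \<open>auto simp: has_vector_derivative_def\<close>)

definition exp_op :: "('a \<Rightarrow> 'a) \<Rightarrow> real \<Rightarrow> 'a \<Rightarrow> 'a::real_normed_vector"
  where "exp_op B t x = (\<Sum>n. (t ^ n / fact n) *\<^sub>R (B ^^ n) x)"

lemma norm_funpow_le:
  fixes B :: "'a::real_normed_vector \<Rightarrow> 'a"
  assumes "\<And>x. norm (B x) \<le> K * norm x" "K \<ge> 0"
  shows "norm ((B ^^ n) x) \<le> K ^ n * norm x"
proof (induction n)
  case (Suc n)
  have "norm ((B ^^ Suc n) x) \<le> K * norm ((B ^^ n) x)"
    using assms(1) by simp
  also have "\<dots> \<le> K * (K ^ n * norm x)"
    using Suc assms(2) by (rule mult_left_mono)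
  finally show ?case by (simp add: mult.assoc)
qed simp

lemma bounded_linear_funpow:
  fixes B :: "'a::real_normed_vector \<Rightarrow> 'a"
  assumes "bounded_linear B"
  shows "bounded_linear (B ^^ n)"
proof (induction n)
  case 0
  then show ?case by (simp add: id_def)
next
  case (Suc n)
  then show ?case
    using bounded_linear_compose[OF assms Suc] by (simp add: o_def)
qed

text \<open>The majorant is uniform for \<open>|t| <= r\<close>, so it serves both convergence at
  one time (\<open>r = |t|\<close>) and the Weierstrass test on an interval.\<close>

lemma exp_op_bound:
  fixes B :: "'a::real_normed_vector \<Rightarrow> 'a"
  assumes "bounded_linear B"
  shows "\<exists>K. \<forall>n t r x. \<bar>t\<bar> \<le> r \<longrightarrow> norm ((t ^ n / fact n) *\<^sub>R (B ^^ n) x) \<le> (r * K) ^ n /\<^sub>R fact n * norm x"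
proof -
  obtain K where K: "K > 0" "\<And>x. norm (B x) \<le> norm x * K"
    using bounded_linear.pos_bounded[OF assms] by blast
  have "norm ((t ^ n / fact n) *\<^sub>R (B ^^ n) x) \<le> (r * K) ^ n /\<^sub>R fact n * norm x" if "\<bar>t\<bar> \<le> r" for n t r x
  proof -
    have "norm ((t ^ n / fact n) *\<^sub>R (B ^^ n) x) \<le> (\<bar>t\<bar> ^ n / fact n) * (K ^ n * norm x)"
      using norm_funpow_le[of B K n x] K
      by (auto simp: mult.commute power_abs intro!: mult_left_mono divide_right_mono)
    also have "\<dots> \<le> (r ^ n / fact n) * (K ^ n * norm x)"
      using that K by (intro mult_right_mono divide_right_mono power_mono) auto
    finally show ?thesis
      by (simp add: power_mult_distrib field_simps)
  qed
  then show ?thesis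
    by blast
qed

lemma exp_op_sums:
  fixes B :: "'a::banach \<Rightarrow> 'a"
  assumes "bounded_linear B"
  shows "(\<lambda>n. (t ^ n / fact n) *\<^sub>R (B ^^ n) x) sums exp_op B t x"
proof -
  obtain K where K: "\<forall>n t r x. \<bar>t\<bar> \<le> r \<longrightarrow> norm ((t ^ n / fact n) *\<^sub>R (B ^^ n) x) \<le> (r * K) ^ n /\<^sub>R fact n * norm x"
    using exp_op_bound[OF assms] ..
  have "summable (\<lambda>n. (t ^ n / fact n) *\<^sub>R (B ^^ n) x)"
  proof (rule summable_comparison_test')
    show "summable (\<lambda>n. (\<bar>t\<bar> * K) ^ n /\<^sub>R fact n * norm x)"
      by (intro summable_mult2 summable_exp_generic)
    show "norm ((t ^ n / fact n) *\<^sub>R (B ^^ n) x) \<le> (\<bar>t\<bar> * K) ^ n /\<^sub>R fact n * norm x" for n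
      by (rule K[rule_format]) simp
  qed
  then show ?thesis
    unfolding exp_op_def by (rule summable_sums)
qed

lemma exp_op_0 [simp]: "exp_op B 0 x = x"
proof -
  have "(\<lambda>n. (0 ^ n / fact n) *\<^sub>R (B ^^ n) x) = (\<lambda>n. if n = 0 then x else 0)"
    by (auto simp: fun_eq_iff)
  then show ?thesis
    unfolding exp_op_def using sums_If_finite[of "\<lambda>n. n = (0::nat)" "\<lambda>_. x"]
    by (simp add: sums_iff)
qed

text \<open>With \<open>C = B\<close> this rewrites the derivative \<open>exp_op B t (B x)\<close>
  as \<open>B (exp_op B t x)\<close>; with other \<open>C\<close> it passes commutation on to the
  semigroup.\<close>

lemma exp_op_commute:
  fixes B C :: "'a::banach \<Rightarrow> 'a"
  assumes "bounded_linear B" "bounded_linear C" "\<And>x. C (B x) = B (C x)"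
  shows "C (exp_op B t x) = exp_op B t (C x)"
proof -
  have "C ((B ^^ n) x) = (B ^^ n) (C x)" for n
    by (induction n) (auto simp: assms(3))
  then have "(\<lambda>n. C ((t ^ n / fact n) *\<^sub>R (B ^^ n) x)) = (\<lambda>n. (t ^ n / fact n) *\<^sub>R (B ^^ n) (C x))"
    using linear_scale[OF bounded_linear.linear[OF assms(2)]] by simp
  with bounded_linear.sums[OF assms(2) exp_op_sums[OF assms(1), of t x]]
  have "(\<lambda>n. (t ^ n / fact n) *\<^sub>R (B ^^ n) (C x)) sums C (exp_op B t x)"
    by simp
  then show ?thesis
    using exp_op_sums[OF assms(1)] by (rule sums_unique2)
qed

lemma exp_op_linear:
  fixes B :: "'a::banach \<Rightarrow> 'a"
  assumes "bounded_linear B"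
  shows "linear (exp_op B t)"
proof -
  have lin: "linear (B ^^ n)" for n
    using bounded_linear_funpow[OF assms] bounded_linear.linear by blast
  show ?thesis
  proof
    fix x y
    have "(\<lambda>n. (t ^ n / fact n) *\<^sub>R (B ^^ n) (x + y)) sums (exp_op B t x + exp_op B t y)"
      using sums_add[OF exp_op_sums[OF assms, of t x] exp_op_sums[OF assms, of t y]]
      by (simp add: linear_add[OF lin] scaleR_add_right)
    then show "exp_op B t (x + y) = exp_op B t x + exp_op B t y"
      using exp_op_sums[OF assms] sums_unique2 by blast
  next
    fix r x
    have "(\<lambda>n. (t ^ n / fact n) *\<^sub>R (B ^^ n) (r *\<^sub>R x)) sums (r *\<^sub>R exp_op B t x)"
      using sums_scaleR_right[OF exp_op_sums[OF assms, of t x], of r]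
      by (simp add: linear_scale[OF lin] mult.commute)
    then show "exp_op B t (r *\<^sub>R x) = r *\<^sub>R exp_op B t x"
      using exp_op_sums[OF assms] sums_unique2 by blast
  qed
qed

lemma exp_op_has_vector_derivative:
  fixes B :: "'a::banach \<Rightarrow> 'a"
  assumes "bounded_linear B"
  shows "((\<lambda>t. exp_op B t x) has_vector_derivative exp_op B t (B x)) (at t within S)"
proof -
  \<comment> \<open>The margin 1 puts \<open>t\<close> in the interior of the interval from
    \<open>-r\<close> to \<open>r\<close>, so the derivative within the interval becomes a
    derivative at \<open>t\<close>.\<close>
  define r where "r = \<bar>t\<bar> + 1"
  define f where "f n t = (t ^ n / fact n) *\<^sub>R (B ^^ n) x" for n t
  define d where "d n t = (t ^ n / fact n) *\<^sub>R (B ^^ n) (B x)" for n t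
  \<comment> \<open>The derivative of the term with index \<open>i + 1\<close> is the term with
    index \<open>i\<close> of the series for \<open>B x\<close>, hence the lengths
    \<open>Suc n\<close> and \<open>n\<close>.\<close>
  have der: "((\<lambda>t. \<Sum>i<Suc n. f i t) has_vector_derivative (\<Sum>i<n. d i s)) (at s within T)" for n s T
  proof -
    have "(f (Suc i) has_vector_derivative d i s) (at s within T)" for i
    proof -
      have "((\<lambda>t. t ^ Suc i / fact (Suc i)) has_field_derivative s ^ i / fact i) (at s within T)"
        by (rule derivative_eq_intros refl | simp add: fact_Suc del: of_nat_Suc)+
      from has_vector_derivative_scaleR[OF this has_vector_derivative_const[of "(B ^^ Suc i) x"]]
      show ?thesis
        unfolding f_def d_def funpow_Suc_right o_def by simp
    qed
    moreover have "(f 0 has_vector_derivative 0) (at s within T)"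
      by (simp add: f_def[abs_def])
    ultimately have "((\<lambda>t. f 0 t + (\<Sum>i<n. f (Suc i) t)) has_vector_derivative 0 + (\<Sum>i<n. d i s)) (at s within T)"
      by (intro has_vector_derivative_add has_vector_derivative_sum)
    then show ?thesis
      by (simp add: sum.lessThan_Suc_shift del: sum.lessThan_Suc)
  qed
  obtain K where K: "\<forall>n t r x. \<bar>t\<bar> \<le> r \<longrightarrow> norm ((t ^ n / fact n) *\<^sub>R (B ^^ n) x) \<le> (r * K) ^ n /\<^sub>R fact n * norm x"
    using exp_op_bound[OF assms] ..
  have "uniform_limit {-r..r} (\<lambda>n t. \<Sum>i<n. d i t) (\<lambda>t. exp_op B t (B x)) sequentially"
    unfolding exp_op_def d_def
  proof (rule Weierstrass_m_test)
    show "summable (\<lambda>n. (r * K) ^ n /\<^sub>R fact n * norm (B x))"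
      by (intro summable_mult2 summable_exp_generic)
    show "norm ((t ^ n / fact n) *\<^sub>R (B ^^ n) (B x)) \<le> (r * K) ^ n /\<^sub>R fact n * norm (B x)"
      if "t \<in> {-r..r}" for n t
      using that by (intro K[rule_format]) auto
  qed
  note unif = this
  have lim: "(\<lambda>n. \<Sum>i<Suc n. f i s) \<longlonglongrightarrow> exp_op B s x" for s
    unfolding f_def by (rule LIMSEQ_Suc[OF exp_op_sums[OF assms, of s x, unfolded sums_def]])
  have t': "t \<in> {-r<..<r}"
    unfolding r_def greaterThanLessThan_iff by linarith
  then have t: "t \<in> {-r..r}"
    by simp
  from has_vector_derivative_sequence[OF convex_real_interval(5) der unif t lim]
  obtain g where g: "\<And>s. s \<in> {-r..r} \<Longrightarrow> (\<lambda>n. \<Sum>i<Suc n. f i s) \<longlonglongrightarrow> g s"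
    "\<And>s. s \<in> {-r..r} \<Longrightarrow> (g has_vector_derivative exp_op B s (B x)) (at s within {-r..r})"
    by blast
  have "g s = exp_op B s x" if "s \<in> {-r..r}" for s
    using g(1)[OF that] lim by (rule LIMSEQ_unique)
  then have "((\<lambda>t. exp_op B t x) has_vector_derivative exp_op B t (B x)) (at t within {-r<..<r})"
    using has_vector_derivative_weaken[OF g(2)[OF t] t', of "\<lambda>t. exp_op B t x"]
    by (simp add: greaterThanLessThan_subseteq_atLeastAtMost_iff)
  then have "((\<lambda>t. exp_op B t x) has_vector_derivative exp_op B t (B x)) (at t)"
    using has_vector_derivative_within_open[OF t' open_greaterThanLessThan] by blast
  then show ?thesis
    by (rule has_vector_derivative_at_within)
qed

text \<open>The derivative of \<open>|u|^2\<close> is \<open>2 <u', u>\<close>, and the mean value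
  theorem bounds the increment. With \<open>c = 0\<close> this is contractivity and uniqueness for
  dissipative equations; with a small positive \<open>c\<close> it is the integration step in Kato's
  estimate.\<close>

lemma norm_power2_growth:
  fixes u :: "real \<Rightarrow> 'a::real_inner"
  assumes der: "\<And>s. s \<in> {0..t} \<Longrightarrow> (u has_vector_derivative u' s) (at s within {0..t})"
    and c: "\<And>s. s \<in> {0..t} \<Longrightarrow> 2 * inner (u' s) (u s) \<le> c"
    and "t \<ge> 0"
  shows "(norm (u t))\<^sup>2 \<le> (norm (u 0))\<^sup>2 + c * t"
proof -
  have "((\<lambda>s. inner (u s) (u s)) has_derivative (\<lambda>h. h * (2 * inner (u' s) (u s)))) (at s within {0..t})"
    if "0 \<le> s" "s \<le> t" for s
    using bounded_bilinear.has_vector_derivative[OF bounded_bilinear_inner der der] that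
    by (force simp: has_vector_derivative_def inner_commute)
  from mvt_very_simple[OF \<open>t \<ge> 0\<close> this] obtain s where "s \<in> {0..t}"
    and "inner (u t) (u t) - inner (u 0) (u 0) = t * (2 * inner (u' s) (u s))"
    by auto
  then show ?thesis
    using mult_left_mono[OF c \<open>t \<ge> 0\<close>, of s] by (simp add: power2_norm_eq_inner mult.commute)
qed

section \<open>Exponentials of dissipative operators\<close>

lemma exp_op_dissipative:
  fixes B :: "'a::{real_inner,banach} \<Rightarrow> 'a"
  assumes "bounded_linear B" "\<And>x. inner (B x) x \<le> 0" "t \<ge> 0"
  shows "norm (exp_op B t x) \<le> norm x"
proof -
  have "(norm (exp_op B t x))\<^sup>2 \<le> (norm (exp_op B 0 x))\<^sup>2 + 0 * t"
  proof (rule norm_power2_growth[OF exp_op_has_vector_derivative[OF assms(1)]])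
    show "2 * inner (exp_op B s (B x)) (exp_op B s x) \<le> 0" for s
      using assms(2)[of "exp_op B s x"] by (simp add: exp_op_commute[OF assms(1,1)])
  qed fact
  then show ?thesis by (simp add: power2_le_iff_abs_le)
qed

text \<open>As functions of \<open>s\<close>, both sides solve \<open>u' = B u\<close> with the same
  value at 0. Their difference solves it too, and dissipativity keeps its norm from growing.\<close>

lemma exp_op_add:
  fixes B :: "'a::{real_inner,banach} \<Rightarrow> 'a"
  assumes B: "bounded_linear B" "\<And>x. inner (B x) x \<le> 0" and "s \<ge> 0" "t \<ge> 0"
  shows "exp_op B (s + t) x = exp_op B s (exp_op B t x)"
proof -
  define u where "u s = exp_op B (s + t) x - exp_op B s (exp_op B t x)" for s
  have "(norm (u s))\<^sup>2 \<le> (norm (u 0))\<^sup>2 + 0 * s"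
  proof (rule norm_power2_growth)
    fix r
    have "((\<lambda>s. exp_op B (s + t) x) has_vector_derivative 1 *\<^sub>R exp_op B (r + t) (B x)) (at r within {0..s})"
      using vector_diff_chain_within[of "\<lambda>s. s + t" 1 r "{0..s}" "\<lambda>s. exp_op B s x"]
        exp_op_has_vector_derivative[OF B(1)]
      by (force intro!: derivative_eq_intros simp: o_def)
    then show "(u has_vector_derivative B (u r)) (at r within {0..s})"
      unfolding u_def
      by (auto intro!: derivative_eq_intros exp_op_has_vector_derivative B
          simp: exp_op_commute[OF B(1,1)] linear_diff[OF bounded_linear.linear[OF B(1)]])
    show "2 * inner (B (u r)) (u r) \<le> 0"
      using B(2) by simp
  qed fact
  then show ?thesis by (simp add: u_def)
qed

section \<open>Contraction semigroups generated by maximal dissipative operators\<close>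

text \<open>The projection theorem: \<open>z = y - p\<close>, where \<open>p\<close> is the point of
  \<open>V\<close> nearest to some \<open>y\<close> outside \<open>V\<close>, obtained as the limit
  of a minimising sequence.\<close>

lemma orthogonal_to_proper_closed_subspace:
  fixes V :: "'a::{real_inner,complete_space} set"
  assumes V: "subspace V" "closed V" "V \<noteq> UNIV"
  obtains z where "z \<noteq> 0" "\<And>v. v \<in> V \<Longrightarrow> inner z v = 0"
proof -
  obtain y where y: "y \<notin> V"
    using V(3) by blast
  define d where "d = infdist y V"
  have ne: "V \<noteq> {}"
    using subspace_0[OF V(1)] by blast
  have d_le: "d \<le> norm (y - v)" if "v \<in> V" for v
    using infdist_le[OF that, of y] by (simp add: d_def dist_norm)
  have d_le_sq: "d\<^sup>2 \<le> (norm (y - v))\<^sup>2" if "v \<in> V" for v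
    using d_le[OF that] by (intro power_mono) (auto simp: d_def infdist_nonneg)
  have "\<exists>v\<in>V. (norm (y - v))\<^sup>2 < d\<^sup>2 + 1 / Suc n" for n
  proof (rule ccontr)
    assume "\<not> ?thesis"
    then have "sqrt (d\<^sup>2 + 1 / Suc n) \<le> norm (y - v)" if "v \<in> V" for v
      using that by (intro real_le_lsqrt) (auto simp: not_less)
    then have "sqrt (d\<^sup>2 + 1 / Suc n) \<le> d"
      unfolding d_def infdist_notempty[OF ne] dist_norm by (intro cINF_greatest[OF ne])
    then have "d\<^sup>2 + 1 / Suc n \<le> d\<^sup>2"
      by (rule sqrt_le_D)
    then show False by (simp add: field_simps)
  qed
  then obtain v where v: "\<And>n. v n \<in> V" "\<And>n. (norm (y - v n))\<^sup>2 < d\<^sup>2 + 1 / Suc n"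
    by metis
  \<comment> \<open>Parallelogram law for \<open>y - v m\<close> and \<open>y - v n\<close>: the
    midpoint of \<open>v m\<close> and \<open>v n\<close> lies in \<open>V\<close>, so its distance
    to \<open>y\<close> is at least \<open>d\<close>.\<close>
  have close: "(norm (v m - v n))\<^sup>2 \<le> 2 / Suc m + 2 / Suc n" for m n
  proof -
    have "d\<^sup>2 \<le> (norm (y - (1/2) *\<^sub>R (v m + v n)))\<^sup>2"
      by (intro d_le_sq subspace_scale subspace_add v V)
    moreover have "(norm (v m - v n))\<^sup>2 = 2 * (norm (y - v m))\<^sup>2 + 2 * (norm (y - v n))\<^sup>2
      - 4 * (norm (y - (1/2) *\<^sub>R (v m + v n)))\<^sup>2"
      unfolding power2_norm_eq_inner by (simp add: algebra_simps inner_commute)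
    ultimately show ?thesis
      using v(2)[of m] v(2)[of n] by simp
  qed
  have "Cauchy v"
  proof (rule metric_CauchyI)
    fix e :: real assume "e > 0"
    then obtain N :: nat where N: "4 / e\<^sup>2 < N"
      using reals_Archimedean2 by blast
    have "dist (v m) (v n) < e" if "m \<ge> N" "n \<ge> N" for m n
    proof -
      have "2 / real (Suc m) \<le> 2 / real (Suc N)" "2 / real (Suc n) \<le> 2 / real (Suc N)"
        using that by (auto intro!: divide_left_mono)
      with close[of m n] have "(norm (v m - v n))\<^sup>2 \<le> 4 / Suc N"
        by simp
      also have "\<dots> < e\<^sup>2"
        using N \<open>e > 0\<close> by (simp add: field_simps add_strict_increasing)
      finally show ?thesis
        using \<open>e > 0\<close> by (simp add: dist_norm power2_less_imp_less)
    qed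
    then show "\<exists>M. \<forall>m\<ge>M. \<forall>n\<ge>M. dist (v m) (v n) < e" by blast
  qed
  then obtain p where p: "v \<longlonglongrightarrow> p"
    using Cauchy_convergent convergent_def by blast
  have "p \<in> V"
    using closed_sequentially[OF V(2) _ p] v by blast
  define z where "z = y - p"
  have "(\<lambda>n. d\<^sup>2 + 1 / real (Suc n)) \<longlonglongrightarrow> d\<^sup>2 + 0"
    by (intro tendsto_add tendsto_const LIMSEQ_Suc lim_1_over_n)
  moreover have "(\<lambda>n. (norm (y - v n))\<^sup>2) \<longlonglongrightarrow> (norm z)\<^sup>2"
    unfolding z_def by (intro tendsto_intros p)
  ultimately have z_le: "(norm z)\<^sup>2 \<le> d\<^sup>2"
    by (intro LIMSEQ_le[of "\<lambda>n. (norm (y - v n))\<^sup>2" "(norm z)\<^sup>2" "\<lambda>n. d\<^sup>2 + 1 / real (Suc n)" "d\<^sup>2"])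
      (use v(2) less_imp_le in auto)
  have "inner z u = 0" if u: "u \<in> V" for u
  proof (cases "u = 0")
    case False
    \<comment> \<open>The coefficient of the projection of \<open>z\<close> onto \<open>u\<close>.
      Moving from \<open>p\<close> to \<open>p + c u\<close> lowers the squared distance to
      \<open>y\<close> by \<open><z, u>^2 / <u, u>\<close>, which minimality forbids unless
      \<open><z, u> = 0\<close>.\<close>
    define c where "c = inner z u / inner u u"
    have "d\<^sup>2 \<le> (norm (y - (p + c *\<^sub>R u)))\<^sup>2"
      by (intro d_le_sq subspace_scale subspace_add V u \<open>p \<in> V\<close>)
    also have "y - (p + c *\<^sub>R u) = z - c *\<^sub>R u"
      by (simp add: z_def)
    finally have "inner z z \<le> inner z z - c * inner z u - c * (inner z u - c * inner u u)"
      using z_le by (simp add: power2_norm_eq_inner inner_diff inner_commute algebra_simps)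
    then have "(inner z u)\<^sup>2 / inner u u \<le> 0"
      using False by (simp add: c_def power2_eq_square)
    moreover have "inner u u > 0"
      using False by simp
    ultimately show ?thesis
      by (simp add: divide_le_0_iff)
  qed simp
  moreover have "z \<noteq> 0"
    using y \<open>p \<in> V\<close> by (auto simp: z_def)
  ultimately show ?thesis using that by blast
qed

lemma subspace_closure:
  fixes V :: "'a::real_normed_vector set"
  assumes "subspace V"
  shows "subspace (closure V)"
proof (rule subspaceI)
  show "0 \<in> closure V"
    using subspace_0[OF assms] closure_subset by blast
next
  fix x y assume "x \<in> closure V" "y \<in> closure V"
  then obtain f g where fg: "\<forall>n. f n \<in> V" "f \<longlonglongrightarrow> x" "\<forall>n. g n \<in> V" "g \<longlonglongrightarrow> y"
    unfolding closure_sequential by blast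
  then have "\<forall>n. f n + g n \<in> V"
    using subspace_add[OF assms] by blast
  then show "x + y \<in> closure V"
    unfolding closure_sequential by (intro exI[of _ "\<lambda>n. f n + g n"] conjI tendsto_add fg)
next
  fix r x assume "x \<in> closure V"
  then obtain f where f: "\<forall>n. f n \<in> V" "f \<longlonglongrightarrow> x"
    unfolding closure_sequential by blast
  then have "\<forall>n. r *\<^sub>R f n \<in> V"
    using subspace_scale[OF assms] by blast
  then show "r *\<^sub>R x \<in> closure V"
    unfolding closure_sequential by (intro exI[of _ "\<lambda>n. r *\<^sub>R f n"] conjI tendsto_intros f)
qed

text \<open>The setting of the Lumer-Phillips theorem over the reals. Density of \<open>D\<close> is
  a consequence (\<open>dense\<close>), and \<open>surj\<close> covers arbitrarily small
  \<open>h\<close> because the approximation lets \<open>h\<close> tend to 0.\<close>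

locale m_dissipative =
  fixes D :: "'a::{real_inner,banach} set" and A :: "'a \<Rightarrow> 'a"
  assumes D: "subspace D"
    and add: "\<And>x y. x \<in> D \<Longrightarrow> y \<in> D \<Longrightarrow> A (x + y) = A x + A y"
    and scale: "\<And>r x. x \<in> D \<Longrightarrow> A (r *\<^sub>R x) = r *\<^sub>R A x"
    and dissipative: "\<And>x. x \<in> D \<Longrightarrow> inner (A x) x \<le> 0"
    and surj: "\<And>h y. h > 0 \<Longrightarrow> \<exists>x\<in>D. x - h *\<^sub>R A x = y"
begin

text \<open>The resolvent \<open>(I - h A)^{-1}\<close>, with \<open>h\<close> the reciprocal of the
  usual spectral parameter.\<close>

definition J :: "real \<Rightarrow> 'a \<Rightarrow> 'a"
  where "J h y = (SOME x. x \<in> D \<and> x - h *\<^sub>R A x = y)"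

text \<open>The Yosida approximation of \<open>A\<close>. It equals \<open>(J h - I) / h\<close>,
  hence is bounded.\<close>

definition B :: "real \<Rightarrow> 'a \<Rightarrow> 'a"
  where "B h y = A (J h y)"

lemma diff: "x \<in> D \<Longrightarrow> y \<in> D \<Longrightarrow> A (x - y) = A x - A y"
  using add[of x "(-1) *\<^sub>R y"] scale[of y "-1"] subspace_neg[OF D] by simp

text \<open>Dissipativity gives \<open>|x|^2 <= <x - h A x, x>\<close>, then Cauchy-Schwarz. Both
  uniqueness of the solution defining \<open>J h\<close> and contractivity of \<open>J h\<close>
  rest on this.\<close>

lemma norm_le: "x \<in> D \<Longrightarrow> h > 0 \<Longrightarrow> norm x \<le> norm (x - h *\<^sub>R A x)"
proof -
  assume x: "x \<in> D" "h > 0"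
  have "(norm x)\<^sup>2 \<le> inner (x - h *\<^sub>R A x) x"
    using dissipative[OF x(1)] x(2) by (simp add: power2_norm_eq_inner inner_diff mult_nonneg_nonpos)
  also have "\<dots> \<le> norm (x - h *\<^sub>R A x) * norm x"
    by (rule norm_cauchy_schwarz)
  finally show ?thesis
    by (metis mult_right_le_imp_le norm_ge_zero power2_eq_square zero_less_norm_iff norm_zero)
qed

lemma J:
  assumes "h > 0"
  shows J_in: "J h y \<in> D" and J_eq: "J h y - h *\<^sub>R B h y = y"
proof -
  have "\<exists>x. x \<in> D \<and> x - h *\<^sub>R A x = y"
    using surj[OF assms, of y] by blast
  from someI_ex[OF this] show "J h y \<in> D" "J h y - h *\<^sub>R B h y = y"
    unfolding J_def B_def by blast+
qed

lemma J_unique: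
  assumes "h > 0" "x \<in> D" "x - h *\<^sub>R A x = y"
  shows "J h y = x"
proof -
  have "J h y - x - h *\<^sub>R A (J h y - x) = (J h y - h *\<^sub>R B h y) - (x - h *\<^sub>R A x)"
    unfolding B_def diff[OF J_in[OF assms(1)] assms(2)] by (simp add: algebra_simps)
  also have "\<dots> = 0"
    using J_eq[OF assms(1)] assms(3) by simp
  finally have "norm (J h y - x) \<le> norm (0 :: 'a)"
    using norm_le[OF subspace_diff[OF D J_in[OF assms(1)] assms(2)] assms(1), of y] by (simp only:)
  then show ?thesis by simp
qed

lemma B_eq: "h > 0 \<Longrightarrow> B h y = (1 / h) *\<^sub>R (J h y - y)"
  using J_eq[of h y] by (simp add: algebra_simps)

lemma norm_J_le: "h > 0 \<Longrightarrow> norm (J h y) \<le> norm y"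
  using norm_le[OF J_in] J_eq[of h y] by (metis B_def)

lemma J_linear: "h > 0 \<Longrightarrow> bounded_linear (J h)"
proof (intro bounded_linear_intro[of _ 1])
  assume h: "h > 0"
  fix x y r
  show "J h (x + y) = J h x + J h y"
  proof (intro J_unique h subspace_add D J_in)
    have "J h x + J h y - h *\<^sub>R A (J h x + J h y) = (J h x - h *\<^sub>R B h x) + (J h y - h *\<^sub>R B h y)"
      by (simp add: add J_in h B_def algebra_simps)
    then show "J h x + J h y - h *\<^sub>R A (J h x + J h y) = x + y"
      by (simp only: J_eq h)
  qed
  show "J h (r *\<^sub>R x) = r *\<^sub>R J h x"
  proof (intro J_unique h subspace_scale D J_in)
    have "r *\<^sub>R J h x - h *\<^sub>R A (r *\<^sub>R J h x) = r *\<^sub>R (J h x - h *\<^sub>R B h x)"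
      by (simp add: scale J_in h B_def scaleR_diff_right mult.commute)
    then show "r *\<^sub>R J h x - h *\<^sub>R A (r *\<^sub>R J h x) = r *\<^sub>R x"
      by (simp add: J_eq h)
  qed
  show "norm (J h x) \<le> norm x * 1"
    using norm_J_le[OF h] by simp
qed

lemma B_linear: "h > 0 \<Longrightarrow> bounded_linear (B h)"
proof -
  assume h: "h > 0"
  then have "B h = (\<lambda>y. (1 / h) *\<^sub>R (J h y - y))"
    using B_eq by blast
  then show ?thesis
    by (auto intro!: bounded_linear_compose[OF bounded_linear_scaleR_right] bounded_linear_sub
        J_linear bounded_linear_ident h)
qed

text \<open>Since \<open>y = J h y - h B h y\<close>, the product \<open><B h y, y>\<close> is
  \<open><A (J h y), J h y> - h |B h y|^2\<close>.\<close>

lemma B_dissipative: "h > 0 \<Longrightarrow> inner (B h y) y \<le> 0"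
proof -
  assume h: "h > 0"
  have "inner (B h y) (J h y - h *\<^sub>R B h y) \<le> 0"
    using dissipative[OF J_in[OF h, of y]] h by (simp add: B_def inner_diff_right)
      (smt (verit) inner_ge_zero mult_nonneg_nonneg)
  then show ?thesis by (simp add: J_eq h)
qed

text \<open>On \<open>D\<close> the operator commutes with its resolvent. Hence \<open>B h x\<close>
  is bounded by \<open>|A x|\<close> independently of \<open>h\<close>, and it tends to
  \<open>A x\<close> once \<open>J h\<close> tends to the identity.\<close>

lemma B_on_D: "h > 0 \<Longrightarrow> x \<in> D \<Longrightarrow> B h x = J h (A x)"
proof -
  assume h: "h > 0" and x: "x \<in> D"
  have "J h x - h *\<^sub>R J h (A x) = J h (x - h *\<^sub>R A x)"
    using bounded_linear.linear[OF J_linear[OF h]] by (simp add: linear_diff linear_scale)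
  also have "\<dots> = x"
    by (rule J_unique) (use h x in auto)
  finally show ?thesis
    using h by (simp add: B_eq algebra_simps flip: scaleR_diff_right)
qed

lemma norm_B_le: "h > 0 \<Longrightarrow> x \<in> D \<Longrightarrow> norm (B h x) \<le> norm (A x)"
  by (simp add: B_on_D norm_J_le)

text \<open>A vector \<open>z\<close> orthogonal to \<open>D\<close> has the form
  \<open>x - A x\<close> with \<open>x\<close> in \<open>D\<close>. Pairing with \<open>x\<close>
  gives \<open>|x|^2 = <A x, x> <= 0\<close>, so \<open>x\<close> and \<open>z\<close>
  vanish.\<close>

lemma dense: "closure D = UNIV"
proof (rule ccontr)
  assume "closure D \<noteq> UNIV"
  then obtain z where z: "z \<noteq> 0" "\<And>v. v \<in> closure D \<Longrightarrow> inner z v = 0"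
    using orthogonal_to_proper_closed_subspace[OF subspace_closure[OF D] closed_closure] by blast
  obtain x where x: "x \<in> D" "x - 1 *\<^sub>R A x = z"
    using surj[of 1 z] by auto
  have "inner (x - A x) x = 0"
    using z(2)[of x] x closure_subset by auto
  then have "inner x x \<le> 0"
    using dissipative[OF x(1)] by (simp add: inner_diff)
  then have "x = 0"
    by (metis inner_gt_zero_iff not_less)
  then show False
    using x z scale[of 0 0] by simp
qed

section \<open>Convergence of the Yosida semigroups\<close>

definition \<delta> :: "nat \<Rightarrow> real"
  where "\<delta> n = 1 / real (Suc n)"

abbreviation E :: "nat \<Rightarrow> real \<Rightarrow> 'a \<Rightarrow> 'a"
  where "E n \<equiv> exp_op (B (\<delta> n))"

definition S :: "real \<Rightarrow> 'a \<Rightarrow> 'a"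
  where "S t x = lim (\<lambda>n. E n t x)"

lemma \<delta>_pos: "\<delta> n > 0"
  by (simp add: \<delta>_def)

lemma \<delta>_mono: "m \<le> n \<Longrightarrow> \<delta> n \<le> \<delta> m"
  by (simp add: \<delta>_def field_simps)

lemma less_\<delta>: "c < e * real N \<Longrightarrow> e > 0 \<Longrightarrow> N \<le> n \<Longrightarrow> c * \<delta> n < e"
  using mult_left_mono[of "real N" "real (Suc n)" e] by (simp add: \<delta>_def field_simps)

text \<open>On \<open>D\<close> the error \<open>J h x - x = h B h x\<close> is at most
  \<open>h |A x|\<close>; density of \<open>D\<close> and contractivity of \<open>J h\<close> extend
  the convergence to every vector.\<close>

lemma J_tendsto: "(\<lambda>n. J (\<delta> n) z) \<longlonglongrightarrow> z"
proof (rule LIMSEQ_I)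
  fix e :: real assume e: "e > 0"
  then obtain x where x: "x \<in> D" "dist x z < e / 3"
    using dense closure_approachable[of z D] by (metis UNIV_I divide_pos_pos zero_less_numeral)
  obtain N :: nat where N: "norm (A x) / (e / 3) < N"
    using reals_Archimedean2 by blast
  have "norm (J (\<delta> n) z - z) < e" if "n \<ge> N" for n
  proof -
    have "norm (J (\<delta> n) (z - x)) \<le> norm (z - x)"
      by (rule norm_J_le[OF \<delta>_pos])
    moreover have "J (\<delta> n) x - x = \<delta> n *\<^sub>R B (\<delta> n) x"
      using J_eq[OF \<delta>_pos, of n x] by (simp add: algebra_simps)
    then have "norm (J (\<delta> n) x - x) \<le> \<delta> n * norm (A x)"
      using norm_B_le[OF \<delta>_pos x(1), of n] \<delta>_pos[of n] by simp
    moreover have "norm (A x) * \<delta> n < e / 3"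
      by (rule less_\<delta>[OF _ _ that]) (use N e in \<open>simp_all add: field_simps\<close>)
    moreover have "J (\<delta> n) z - z = J (\<delta> n) (z - x) + (J (\<delta> n) x - x) - (z - x)"
      using linear_diff[OF bounded_linear.linear[OF J_linear[OF \<delta>_pos]], of n z x] by simp
    then have "norm (J (\<delta> n) z - z) \<le> norm (J (\<delta> n) (z - x)) + norm (J (\<delta> n) x - x) + norm (z - x)"
      using norm_triangle_ineq4[of "J (\<delta> n) (z - x) + (J (\<delta> n) x - x)" "z - x"]
        norm_triangle_ineq[of "J (\<delta> n) (z - x)" "J (\<delta> n) x - x"] by simp
    ultimately show ?thesis
      using x(2) by (simp add: dist_norm norm_minus_commute mult.commute)
  qed
  then show "\<exists>N. \<forall>n\<ge>N. norm (J (\<delta> n) z - z) < e" by blast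
qed

lemma norm_E_le: "t \<ge> 0 \<Longrightarrow> norm (E n t x) \<le> norm x"
  by (intro exp_op_dissipative B_linear B_dissipative \<delta>_pos)

text \<open>Kato's estimate: the Yosida approximations \<open>B h\<close> and \<open>B k\<close> are compared through the dissipativity of \<open>A\<close>
  at the points \<open>J h u\<close> and \<open>J k v\<close>.\<close>

lemma E_Cauchy_on_D:
  assumes x: "x \<in> D" and t: "t \<ge> 0"
  shows "(norm (E m t x - E n t x))\<^sup>2 \<le> 4 * (norm (A x))\<^sup>2 * (\<delta> m + \<delta> n) * t"
proof -
  define M where "M = norm (A x)"
  define u where "u s = E m s x" for s
  define v where "v s = E n s x" for s
  \<comment> \<open>The constant is \<open>2\<close> from differentiating the square, times
    \<open>2 M\<close> for \<open>|p - q|\<close>, times \<open>M (\<delta> m + \<delta> n)\<close>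
    for the Yosida errors.\<close>
  have "(norm (u t - v t))\<^sup>2 \<le> (norm (u 0 - v 0))\<^sup>2 + (4 * M\<^sup>2 * (\<delta> m + \<delta> n)) * t"
  proof (rule norm_power2_growth[OF _ _ t])
    fix s assume s: "s \<in> {0..t}"
    define p where "p = B (\<delta> m) (u s)"
    define q where "q = B (\<delta> n) (v s)"
    \<comment> \<open>Moving \<open>B\<close> inside the contraction \<open>E\<close> onto the
      initial vector \<open>x\<close> in \<open>D\<close> bounds \<open>p\<close> and
      \<open>q\<close> by \<open>|A x|\<close>, uniformly in \<open>s\<close>, \<open>m\<close> and
      \<open>n\<close>.\<close>
    have p_eq: "p = E m s (B (\<delta> m) x)" and q_eq: "q = E n s (B (\<delta> n) x)"
      unfolding p_def q_def u_def v_def by (rule exp_op_commute; simp add: B_linear \<delta>_pos)+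
    show "((\<lambda>s. u s - v s) has_vector_derivative p - q) (at s within {0..t})"
      unfolding p_eq q_eq u_def v_def
      by (intro has_vector_derivative_diff exp_op_has_vector_derivative B_linear \<delta>_pos)
    have pq: "norm p \<le> M" "norm q \<le> M"
      using norm_E_le norm_B_le[OF \<delta>_pos x] s unfolding p_eq q_eq M_def
      by (meson atLeastAtMost_iff order_trans)+
    have "norm (p - q) \<le> 2 * M"
      using norm_triangle_ineq4[of p q] pq by simp
    moreover have "norm (\<delta> n *\<^sub>R q - \<delta> m *\<^sub>R p) \<le> (\<delta> m + \<delta> n) * M"
    proof -
      have "norm (\<delta> n *\<^sub>R q - \<delta> m *\<^sub>R p) \<le> \<delta> n * norm q + \<delta> m * norm p"
        using norm_triangle_ineq4[of "\<delta> n *\<^sub>R q" "\<delta> m *\<^sub>R p"] \<delta>_pos[of n] \<delta>_pos[of m]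
        by simp
      also have "\<dots> \<le> \<delta> n * M + \<delta> m * M"
        using pq \<delta>_pos[of n] \<delta>_pos[of m] by (intro add_mono mult_left_mono) auto
      finally show ?thesis by (simp add: algebra_simps)
    qed
    ultimately have "norm (p - q) * norm (\<delta> n *\<^sub>R q - \<delta> m *\<^sub>R p) \<le> (2 * M) * ((\<delta> m + \<delta> n) * M)"
      by (intro mult_mono) (auto simp: M_def)
    then have "inner (p - q) (\<delta> n *\<^sub>R q - \<delta> m *\<^sub>R p) \<le> 2 * M\<^sup>2 * (\<delta> m + \<delta> n)"
      using norm_cauchy_schwarz[of "p - q" "\<delta> n *\<^sub>R q - \<delta> m *\<^sub>R p"]
      by (simp add: power2_eq_square algebra_simps)
    moreover have "inner (p - q) (J (\<delta> m) (u s) - J (\<delta> n) (v s)) \<le> 0"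
      using dissipative[OF subspace_diff[OF D J_in[OF \<delta>_pos, of m "u s"] J_in[OF \<delta>_pos, of n "v s"]]]
      unfolding p_def q_def B_def by (simp add: diff J_in \<delta>_pos)
    \<comment> \<open>Each trajectory is its resolvent image minus the step size times its
      derivative. The resolvent images lie in \<open>D\<close>, where dissipativity applies; the
      remainder is of the order of the step sizes.\<close>
    moreover have "u s - v s = (J (\<delta> m) (u s) - J (\<delta> n) (v s)) + (\<delta> n *\<^sub>R q - \<delta> m *\<^sub>R p)"
      using J_eq[OF \<delta>_pos, of m "u s"] J_eq[OF \<delta>_pos, of n "v s"] unfolding p_def q_def
      by (simp add: algebra_simps)
    then have "inner (p - q) (u s - v s) =
      inner (p - q) (J (\<delta> m) (u s) - J (\<delta> n) (v s)) + inner (p - q) (\<delta> n *\<^sub>R q - \<delta> m *\<^sub>R p)"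
      by (metis inner_add_right)
    ultimately show "2 * inner (p - q) (u s - v s) \<le> 4 * M\<^sup>2 * (\<delta> m + \<delta> n)"
      by linarith
  qed
  then show ?thesis by (simp add: u_def v_def M_def)
qed

lemma E_uniform_limit: "uniform_limit {0..b} (\<lambda>n t. E n t x) (\<lambda>t. S t x) sequentially"
proof -
  have "uniformly_Cauchy_on {0..b} (\<lambda>n t. E n t x)"
  proof (rule uniformly_Cauchy_onI)
    fix e :: real assume e: "e > 0"
    then obtain y where y: "y \<in> D" "dist y x < e / 4"
      using dense closure_approachable[of x D] by (metis UNIV_I divide_pos_pos zero_less_numeral)
    \<comment> \<open>The 8 is the 4 of Kato's estimate times the 2 from
      \<open>\<delta> m + \<delta> n <= 2 \<delta> N\<close> for \<open>m, n >= N\<close>.\<close>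
    define M where "M = 8 * (norm (A y))\<^sup>2 * max b 0"
    obtain N :: nat where N: "M / (e / 2)\<^sup>2 < N"
      using reals_Archimedean2 by blast
    have "dist (E m t x) (E n t x) < e" if t: "t \<in> {0..b}" and mn: "m \<ge> N" "n \<ge> N" for t m n
    proof -
      have "(\<delta> m + \<delta> n) * t \<le> (2 * \<delta> N) * max b 0"
        using t \<delta>_mono[OF mn(1)] \<delta>_mono[OF mn(2)] \<delta>_pos[of N]
        by (intro mult_mono) (linarith | simp)+
      from mult_left_mono[OF this, of "4 * (norm (A y))\<^sup>2"]
      have "4 * (norm (A y))\<^sup>2 * (\<delta> m + \<delta> n) * t \<le> M * \<delta> N"
        by (simp add: M_def mult.assoc mult.left_commute mult.commute)
      also have "\<dots> < (e / 2)\<^sup>2"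
        by (rule less_\<delta>[of _ _ N]) (use N e in \<open>simp_all add: field_simps\<close>)
      finally have "(norm (E m t y - E n t y))\<^sup>2 < (e / 2)\<^sup>2"
        using E_Cauchy_on_D[OF y(1), of t m n] t by simp
      then have 1: "norm (E m t y - E n t y) < e / 2"
        by (rule power2_less_imp_less) (use e in simp)
      have 2: "norm (E k t (x - y)) < e / 4" for k
        using norm_E_le[of t k "x - y"] t y(2) by (simp add: dist_norm norm_minus_commute)
      have eq: "E k t (x - y) = E k t x - E k t y" for k
        using exp_op_linear[OF B_linear[OF \<delta>_pos]] by (rule linear_diff)
      have "norm (E m t x - E n t x) = norm (E m t (x - y) + (E m t y - E n t y) - E n t (x - y))"
        unfolding eq by (simp add: algebra_simps)
      also have "\<dots> \<le> norm (E m t (x - y)) + norm (E m t y - E n t y) + norm (E n t (x - y))"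
        using norm_triangle_ineq4[of "E m t (x - y) + (E m t y - E n t y)" "E n t (x - y)"]
          norm_triangle_ineq[of "E m t (x - y)" "E m t y - E n t y"] by linarith
      finally show ?thesis
        using 1 2[of m] 2[of n] by (simp add: dist_norm)
    qed
    then show "\<exists>M. \<forall>t\<in>{0..b}. \<forall>m\<ge>M. \<forall>n\<ge>M. dist (E m t x) (E n t x) < e"
      by blast
  qed
  then show ?thesis
    using Cauchy_uniformly_convergent by (auto simp: uniformly_convergent_uniform_limit_iff S_def)
qed

section \<open>Properties of the limit semigroup\<close>

lemma E_tendsto: "t \<ge> 0 \<Longrightarrow> (\<lambda>n. E n t x) \<longlonglongrightarrow> S t x"
  using tendsto_uniform_limitI[OF E_uniform_limit[where b = t], of t] by simp

lemma S_0: "S 0 x = x"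
  using E_tendsto[of 0 x] by (simp add: LIMSEQ_const_iff)

lemma norm_S_le: "t \<ge> 0 \<Longrightarrow> norm (S t x) \<le> norm x"
  by (rule Lim_bounded[OF tendsto_norm[OF E_tendsto]]) (auto intro: norm_E_le)

lemma S_linear: "t \<ge> 0 \<Longrightarrow> bounded_linear (S t)"
proof (intro bounded_linear_intro[of _ 1])
  assume t: "t \<ge> 0"
  fix x y r
  have lin: "linear (E n t)" for n
    by (rule exp_op_linear[OF B_linear[OF \<delta>_pos]])
  show "S t (x + y) = S t x + S t y"
    using E_tendsto[OF t, of "x + y"] tendsto_add[OF E_tendsto[OF t, of x] E_tendsto[OF t, of y]]
    unfolding linear_add[OF lin] by (rule LIMSEQ_unique)
  show "S t (r *\<^sub>R x) = r *\<^sub>R S t x"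
    using E_tendsto[OF t, of "r *\<^sub>R x"] tendsto_scaleR[OF tendsto_const E_tendsto[OF t, of x], of r]
    unfolding linear_scale[OF lin] by (rule LIMSEQ_unique)
  show "norm (S t x) \<le> norm x * 1"
    using norm_S_le[OF t] by simp
qed

text \<open>The law passes to the limit although both factors vary with \<open>n\<close>:
  \<open>E n s\<close> is a contraction, so it sends the null sequence
  \<open>E n t x - S t x\<close> to a null sequence.\<close>

lemma S_add:
  assumes "s \<ge> 0" "t \<ge> 0"
  shows "S (s + t) x = S s (S t x)"
proof -
  have "(\<lambda>n. E n t x - S t x) \<longlonglongrightarrow> 0"
    by (rule LIM_zero[OF E_tendsto[OF assms(2)]])
  then have "(\<lambda>n. E n s (E n t x - S t x)) \<longlonglongrightarrow> 0"
    by (rule tendsto_0_le[where K = 1]) (simp add: norm_E_le[OF assms(1)])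
  from tendsto_add[OF this E_tendsto[OF assms(1), of "S t x"]]
  have "(\<lambda>n. E n s (E n t x)) \<longlonglongrightarrow> S s (S t x)"
    using linear_diff[OF exp_op_linear[OF B_linear[OF \<delta>_pos]]] by simp
  moreover have "E n (s + t) x = E n s (E n t x)" for n
    by (intro exp_op_add B_linear B_dissipative \<delta>_pos assms)
  ultimately show ?thesis
    using E_tendsto[of "s + t" x] assms by (simp add: LIMSEQ_unique)
qed

lemma S_continuous: "continuous_on {0..b} (\<lambda>t. S t x)"
proof (rule uniform_limit_theorem[OF _ E_uniform_limit])
  have "continuous_on {0..b} (\<lambda>t. E n t x)" for n
    by (rule continuous_on_vector_derivative[OF exp_op_has_vector_derivative[OF B_linear[OF \<delta>_pos]]])
  then show "\<forall>\<^sub>F n in sequentially. continuous_on {0..b} (\<lambda>t. E n t x)"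
    by simp
qed simp

text \<open>The approximations have derivative \<open>E n t (J (\<delta> n) (A x))\<close>. As
  \<open>J (\<delta> n) (A x)\<close> tends to \<open>A x\<close> and \<open>E n t\<close> is
  contractive, these derivatives converge to \<open>S t (A x)\<close> uniformly in \<open>t\<close>,
  which permits differentiation of the limit.\<close>

lemma S_has_vector_derivative:
  assumes x: "x \<in> D" and t: "t \<in> {0..b}"
  shows "((\<lambda>t. S t x) has_vector_derivative S t (A x)) (at t within {0..b})"
proof -
  have "uniform_limit {0..b} (\<lambda>n t. E n t (J (\<delta> n) (A x) - A x)) (\<lambda>_. 0) sequentially"
  proof (rule uniform_limitI)
    fix e :: real assume "e > 0"
    with J_tendsto[of "A x"] have "\<forall>\<^sub>F n in sequentially. dist (J (\<delta> n) (A x)) (A x) < e"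
      by (rule tendstoD)
    then show "\<forall>\<^sub>F n in sequentially. \<forall>t\<in>{0..b}. dist (E n t (J (\<delta> n) (A x) - A x)) 0 < e"
    proof eventually_elim
      case (elim n)
      then show ?case
        using order.strict_trans1[OF norm_E_le] by (auto simp: dist_norm)
    qed
  qed
  from uniform_limit_add[OF this E_uniform_limit[where b = b and x = "A x"]]
  have unif: "uniform_limit {0..b} (\<lambda>n t. E n t (B (\<delta> n) x)) (\<lambda>t. S t (A x)) sequentially"
    using linear_diff[OF exp_op_linear[OF B_linear[OF \<delta>_pos]]] by (simp add: B_on_D[OF \<delta>_pos x])
  have t0: "t \<ge> 0"
    using t by simp
  from has_vector_derivative_sequence[OF convex_real_interval(5) exp_op_has_vector_derivative[OF B_linear[OF \<delta>_pos]]
      unif t E_tendsto[OF t0]]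
  obtain g where g: "\<And>s. s \<in> {0..b} \<Longrightarrow> (\<lambda>n. E n s x) \<longlonglongrightarrow> g s"
    "\<And>s. s \<in> {0..b} \<Longrightarrow> (g has_vector_derivative S s (A x)) (at s within {0..b})"
    by blast
  have "g s = S s x" if "s \<in> {0..b}" for s
  proof (rule LIMSEQ_unique[OF g(1)[OF that]])
    show "(\<lambda>n. E n s x) \<longlonglongrightarrow> S s x"
      using that by (intro E_tendsto) simp
  qed
  then show ?thesis
    using has_vector_derivative_transform[OF t _ g(2)[OF t]] by simp
qed

text \<open>Uniqueness of the resolvent equation makes \<open>C\<close> commute with
  \<open>J\<close>, hence with \<open>B\<close>, with its exponential and with the limit.\<close>

lemma S_commute:
  assumes C: "bounded_linear C" "\<And>x. x \<in> D \<Longrightarrow> C x \<in> D" "\<And>x. x \<in> D \<Longrightarrow> A (C x) = C (A x)"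
    and t: "t \<ge> 0"
  shows "C (S t x) = S t (C x)"
proof -
  note lin = bounded_linear.linear[OF C(1)]
  have J: "J (\<delta> n) (C x) = C (J (\<delta> n) x)" for n x
  proof (rule J_unique[OF \<delta>_pos C(2)[OF J_in[OF \<delta>_pos]]])
    have "C (J (\<delta> n) x) - \<delta> n *\<^sub>R A (C (J (\<delta> n) x)) = C (J (\<delta> n) x - \<delta> n *\<^sub>R B (\<delta> n) x)"
      using C(3)[OF J_in[OF \<delta>_pos]] by (simp add: B_def linear_diff[OF lin] linear_scale[OF lin])
    then show "C (J (\<delta> n) x) - \<delta> n *\<^sub>R A (C (J (\<delta> n) x)) = C x"
      using J_eq[OF \<delta>_pos] by simp
  qed
  have "C (B (\<delta> n) x) = B (\<delta> n) (C x)" for n x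
    using C(3)[OF J_in[OF \<delta>_pos]] unfolding B_def J by simp
  then have "C (E n t x) = E n t (C x)" for n
    by (intro exp_op_commute B_linear \<delta>_pos C)
  with bounded_linear.tendsto[OF C(1) E_tendsto[OF t, of x]]
  have "(\<lambda>n. E n t (C x)) \<longlonglongrightarrow> C (S t x)"
    by simp
  then show ?thesis
    using E_tendsto[OF t] by (rule LIMSEQ_unique)
qed

end

section \<open>Two-isometries and their semigroups\<close>

instance chilbert_space \<subseteq> banach ..

section \<open>Complex scalars\<close>

lemma scaleC_one [simp]: "1 *\<^sub>C (x :: 'a::complex_inner) = x"
  using scaleR_eq_scaleC[of 1 x] by simp

lemma norm_scaleC: "norm (c *\<^sub>C x) = cmod c * norm (x :: 'a::complex_inner)"
proof -
  have *: "cinner x (c *\<^sub>C x) = cnj c * cinner x x"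
    using cinner_commute[of x "c *\<^sub>C x"] cinner_commute[of x x] by (simp add: cinner_scaleC_left)
  have "cinner (c *\<^sub>C x) (c *\<^sub>C x) = (c * cnj c) * cinner x x"
    by (simp add: cinner_scaleC_left *)
  also have "c * cnj c = complex_of_real ((cmod c)\<^sup>2)"
    by (rule complex_norm_square[symmetric])
  finally have "(norm (c *\<^sub>C x))\<^sup>2 = (cmod c * norm x)\<^sup>2"
    by (simp add: power2_norm_eq_inner inner_eq_Re_cinner power_mult_distrib)
  then show ?thesis
    by (simp add: power2_eq_iff_nonneg)
qed

lemma bounded_linear_scaleC: "bounded_linear (\<lambda>x :: 'a::complex_inner. c *\<^sub>C x)"
  by (rule bounded_linear_intro[of _ "cmod c"])
    (simp_all add: scaleC_add_right scaleR_eq_scaleC scaleC_scaleC norm_scaleC mult.commute)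

section \<open>Power growth and resolvent of a 2-isometry\<close>

lemma two_isometry_norm_funpow:
  assumes "two_isometry T"
  shows "(norm ((T ^^ n) x))\<^sup>2 = (norm x)\<^sup>2 + real n * ((norm (T x))\<^sup>2 - (norm x)\<^sup>2)"
proof (induction n rule: induct_nat_012)
  case (ge2 n)
  have "(norm (T (T ((T ^^ n) x))))\<^sup>2 - 2 * (norm (T ((T ^^ n) x)))\<^sup>2 + (norm ((T ^^ n) x))\<^sup>2 = 0"
    using assms unfolding two_isometry_def by blast
  then show ?case
    using ge2 by (simp add: algebra_simps)
qed auto

text \<open>The Neumann series of \<open>(\<rho> T)^n y\<close> converges. The affine growth of
  \<open>|T^n y|^2\<close> is weakened to the linear bound \<open>(n + 1) M\<close> on the norm, so
  that the derivative of the geometric series is a majorant.\<close>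

lemma two_isometry_resolvent:
  fixes T :: "'a::chilbert_space \<Rightarrow> 'a"
  assumes T: "two_isometry T" and \<rho>: "\<bar>\<rho>\<bar> < 1"
  shows "\<exists>v. v - \<rho> *\<^sub>R T v = y"
proof -
  have bl: "bounded_linear T"
    using T by (simp add: two_isometry_def bounded_clinear_def)
  define M where "M = norm y + norm (T y)"
  have growth: "norm ((T ^^ n) y) \<le> real (Suc n) * M" for n
  proof (rule power2_le_imp_le)
    have "(norm ((T ^^ n) y))\<^sup>2 \<le> (norm y)\<^sup>2 + real n * (norm (T y))\<^sup>2"
      by (simp add: two_isometry_norm_funpow[OF T] mult_left_mono)
    also have "\<dots> \<le> real (Suc n) * ((norm y)\<^sup>2 + (norm (T y))\<^sup>2)"
      by (simp add: algebra_simps)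
    also have "\<dots> \<le> (real (Suc n))\<^sup>2 * M\<^sup>2"
    proof (rule mult_mono)
      show "real (Suc n) \<le> (real (Suc n))\<^sup>2"
        using self_le_power[of "real (Suc n)" 2] by simp
      show "(norm y)\<^sup>2 + (norm (T y))\<^sup>2 \<le> M\<^sup>2"
        by (simp add: M_def power2_sum)
    qed auto
    finally show "(norm ((T ^^ n) y))\<^sup>2 \<le> (real (Suc n) * M)\<^sup>2"
      by (simp only: power_mult_distrib)
  qed (simp add: M_def)
  define f where "f n = \<rho> ^ n *\<^sub>R (T ^^ n) y" for n
  have "summable f"
  proof (rule summable_comparison_test')
    show "summable (\<lambda>n. of_nat (Suc n) * \<bar>\<rho>\<bar> ^ n * M)"
      using geometric_deriv_sums[of "\<bar>\<rho>\<bar>"] \<rho> by (intro summable_mult2) (simp add: sums_iff)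
    show "norm (f n) \<le> of_nat (Suc n) * \<bar>\<rho>\<bar> ^ n * M" for n
      using mult_left_mono[OF growth[of n], of "\<bar>\<rho>\<bar> ^ n"]
      by (simp add: f_def power_abs mult.assoc mult.left_commute)
  qed
  then have f: "f sums suminf f"
    by (rule summable_sums)
  have "(\<lambda>n. \<rho> *\<^sub>R T (f n)) sums (\<rho> *\<^sub>R T (suminf f))"
    by (intro sums_scaleR_right bounded_linear.sums[OF bl] f)
  moreover have "\<rho> *\<^sub>R T (f n) = f (Suc n)" for n
    by (simp add: f_def linear_scale[OF bounded_linear.linear[OF bl]])
  moreover have "(\<lambda>n. f (Suc n)) sums (suminf f - y)"
    using f by (subst sums_Suc_iff) (simp add: f_def)
  ultimately have "\<rho> *\<^sub>R T (suminf f) = suminf f - y"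
    by (simp add: sums_unique2)
  then show ?thesis
    by (intro exI[of _ "suminf f"]) simp
qed

text \<open>By \<open>eq\<close>, the derivative \<open>2 <u', u>\<close> of \<open>|u|^2\<close> is
  constant, so \<open>|u|^2\<close> is affine and its second difference at \<open>0\<close>,
  \<open>t\<close>, \<open>2 t\<close> vanishes. Along an orbit of a semigroup this is the
  2-isometry identity for the operator at time \<open>t\<close>.\<close>

lemma norm_power2_affine:
  fixes u :: "real \<Rightarrow> 'a::real_inner"
  assumes u: "\<And>s. s \<in> {0..2 * t} \<Longrightarrow> (u has_vector_derivative u' s) (at s within {0..2 * t})"
    and u': "\<And>s. s \<in> {0..2 * t} \<Longrightarrow> (u' has_vector_derivative u'' s) (at s within {0..2 * t})"
    and eq: "\<And>s. s \<in> {0..2 * t} \<Longrightarrow> inner (u'' s) (u s) + inner (u' s) (u' s) = 0"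
    and t: "t \<ge> 0"
  shows "(norm (u (2 * t)))\<^sup>2 - 2 * (norm (u t))\<^sup>2 + (norm (u 0))\<^sup>2 = 0"
proof -
  note inner_der = bounded_bilinear.has_vector_derivative[OF bounded_bilinear_inner]
  have "((\<lambda>s. inner (u' s) (u s)) has_vector_derivative 0) (at s within {0..2 * t})"
    if "s \<in> {0..2 * t}" for s
    using inner_der[OF u'[OF that] u[OF that]] eq[OF that] by (simp add: add.commute)
  from has_vector_derivative_zero_constant[OF convex_real_interval(5) this]
  obtain c where c: "\<And>s. s \<in> {0..2 * t} \<Longrightarrow> inner (u' s) (u s) = c"
    by blast
  have "((\<lambda>s. inner (u s) (u s) - (2 * c) * s) has_vector_derivative 0) (at s within {0..2 * t})"
    if s: "s \<in> {0..2 * t}" for s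
    using has_vector_derivative_diff[OF inner_der[OF u[OF s] u[OF s]]
        has_vector_derivative_mult_right[OF has_vector_derivative_id, of "2 * c"]] c[OF s]
    by (simp add: inner_commute)
  from has_vector_derivative_zero_constant[OF convex_real_interval(5) this]
  obtain k where k: "\<And>s. s \<in> {0..2 * t} \<Longrightarrow> inner (u s) (u s) - (2 * c) * s = k"
    by blast
  show ?thesis
    unfolding power2_norm_eq_inner using k[of 0] k[of t] k[of "2 * t"] t by simp
qed

section \<open>One-sided derivatives and generators\<close>

lemma has_vector_derivative_imp_tendsto_at_right:
  assumes "(f has_vector_derivative d) (at 0 within {0..1})"
  shows "((\<lambda>t. (f t - f 0) /\<^sub>R t) \<longlongrightarrow> d) (at_right 0)"
proof -
  have "((\<lambda>t. (1 / norm t) *\<^sub>R (f t - (f 0 + t *\<^sub>R d))) \<longlongrightarrow> 0) (at_right 0)"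
    using assms by (simp add: has_vector_derivative_def has_derivative_within at_within_Icc_at_right)
  moreover have "\<forall>\<^sub>F t in at_right 0. (1 / norm t) *\<^sub>R (f t - (f 0 + t *\<^sub>R d)) = (f t - f 0) /\<^sub>R t - d"
    using eventually_at_right_less[of "0::real"]
    by eventually_elim (simp add: algebra_simps divide_inverse)
  ultimately have "((\<lambda>t. (f t - f 0) /\<^sub>R t - d) \<longlongrightarrow> 0) (at_right 0)"
    by (rule Lim_transform_eventually)
  then show ?thesis
    by (rule LIM_zero_cancel)
qed

lemma tendsto_generator:
  assumes "x \<in> generator_dom S"
  shows "((\<lambda>t. (S t x - x) /\<^sub>R t) \<longlongrightarrow> generator S x) (at_right 0)"
  using assms tendsto_Lim[OF trivial_limit_at_right_real]
  unfolding generator_dom_def generator_def by fastforce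

lemma generator_eqI:
  assumes "((\<lambda>t. (S t x - x) /\<^sub>R t) \<longlongrightarrow> y) (at_right 0)"
  shows "x \<in> generator_dom S" "generator S x = y"
  using assms tendsto_Lim[OF trivial_limit_at_right_real]
  unfolding generator_dom_def generator_def by blast+

section \<open>The semigroup with cogenerator \<open>T\<close>\<close>

locale cogenerator_two_isometry =
  fixes T :: "'a::chilbert_space \<Rightarrow> 'a" and w :: real
  assumes T: "two_isometry T"
    and no_eigenvalue: "\<not> eigenvalue T 1"
    and w: "w \<ge> 0"
    and bound: "\<And>x. (norm (T x))\<^sup>2 - (norm x)\<^sup>2 \<le> w * (norm (T x - x))\<^sup>2"
begin

definition D :: "'a set"
  where "D = range (\<lambda>v. T v - v)"

definition A :: "'a \<Rightarrow> 'a"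
  where "A x = (let v = inv (\<lambda>v. T v - v) x in T v + v)"

lemma T_linear: "bounded_linear T"
  using T by (simp add: two_isometry_def bounded_clinear_def)

lemma T_scaleC: "T (c *\<^sub>C x) = c *\<^sub>C T x"
  using T by (simp add: two_isometry_def bounded_clinear_def)

lemmas T_simps = linear_add[OF bounded_linear.linear[OF T_linear]]
  linear_diff[OF bounded_linear.linear[OF T_linear]]
  linear_scale[OF bounded_linear.linear[OF T_linear]]
  linear_0[OF bounded_linear.linear[OF T_linear]]

lemma inj: "inj (\<lambda>v. T v - v)"
proof (rule injI)
  fix u v assume "T u - u = T v - v"
  then have "T (u - v) = 1 *\<^sub>C (u - v)"
    by (simp add: T_simps algebra_simps)
  then show "u = v"
    using no_eigenvalue unfolding eigenvalue_def by (metis right_minus_eq)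
qed

lemma A_eq: "A (T v - v) = T v + v"
  by (simp add: A_def inv_f_f[OF inj])

lemma A_add: "x \<in> D \<Longrightarrow> y \<in> D \<Longrightarrow> A (x + y) = A x + A y"
proof -
  assume "x \<in> D" "y \<in> D"
  then obtain u v where uv: "x = T u - u" "y = T v - v"
    by (auto simp: D_def)
  have "x + y = T (u + v) - (u + v)"
    by (simp add: uv T_simps)
  then show ?thesis
    by (simp only: A_eq uv) (simp add: T_simps)
qed

text \<open>Applied to real scalars (homogeneity of \<open>A\<close>), to complex scalars (complex
  linearity of the semigroup) and to \<open>T\<close> itself.\<close>

lemma A_commute:
  assumes C: "bounded_linear C" "\<And>x. C (T x) = T (C x)" and x: "x \<in> D"
  shows "C x \<in> D" "A (C x) = C (A x)"
proof -
  obtain v where v: "x = T v - v"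
    using x by (auto simp: D_def)
  have "C x = T (C v) - C v"
    by (simp add: v C(2) linear_diff[OF bounded_linear.linear[OF C(1)]])
  moreover have "A (T (C v) - C v) = C (A (T v - v))"
    unfolding A_eq by (simp add: C(2) linear_add[OF bounded_linear.linear[OF C(1)]])
  ultimately show "C x \<in> D" "A (C x) = C (A x)"
    by (simp_all add: D_def v)
qed

sublocale m_dissipative D "\<lambda>x. A x - w *\<^sub>R x"
proof
  show "subspace D"
    unfolding D_def
    by (intro linear_subspace_image subspace_UNIV linear_compose_sub bounded_linear.linear T_linear
        bounded_linear_ident)
  show "A (x + y) - w *\<^sub>R (x + y) = (A x - w *\<^sub>R x) + (A y - w *\<^sub>R y)" if "x \<in> D" "y \<in> D" for x y
    using A_add[OF that] by (simp add: scaleR_add_right)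
  show "A (r *\<^sub>R x) - w *\<^sub>R r *\<^sub>R x = r *\<^sub>R (A x - w *\<^sub>R x)" if "x \<in> D" for r x
    using A_commute(2)[OF bounded_linear_scaleR_right _ that, of r]
    by (simp add: T_simps scaleR_diff_right mult.commute)
  show "inner (A x - w *\<^sub>R x) x \<le> 0" if x: "x \<in> D" for x
  proof -
    obtain v where v: "x = T v - v"
      using x by (auto simp: D_def)
    have "inner (T v + v) (T v - v) = (norm (T v))\<^sup>2 - (norm v)\<^sup>2"
      by (simp add: power2_norm_eq_inner inner_add_left inner_add_right inner_diff_left inner_diff_right
          inner_commute)
    then show ?thesis
      using bound[of v] unfolding v A_eq by (simp add: inner_diff_left power2_norm_eq_inner)
  qed
  show "\<exists>x\<in>D. x - h *\<^sub>R (A x - w *\<^sub>R x) = y" if h: "h > 0" for h y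
  proof -
    \<comment> \<open>With \<open>x = T v - v\<close>, the equation
      \<open>x - h (A x - w x) = y\<close> reads \<open>c v - (1 + h w - h) T v = -y\<close>.
      Dividing by \<open>c\<close> leaves a Neumann equation whose ratio satisfies
      \<open>|\<rho>| < 1\<close> because \<open>h > 0\<close> and \<open>w >= 0\<close>.\<close>
    define c where "c = 1 + h * w + h"
    define \<rho> where "\<rho> = (1 + h * w - h) / c"
    have hw: "h * w \<ge> 0"
      using h w by simp
    then have c: "c > 0"
      using h by (simp add: c_def)
    have "\<bar>1 + h * w - h\<bar> < c"
      unfolding c_def using h hw by linarith
    then have "\<bar>\<rho>\<bar> < 1"
      using c by (simp add: \<rho>_def)
    then obtain v where v: "v - \<rho> *\<^sub>R T v = - (1 / c) *\<^sub>R y"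
      using two_isometry_resolvent[OF T] by blast
    have "(T v - v) - h *\<^sub>R ((T v + v) - w *\<^sub>R (T v - v)) = - (c *\<^sub>R v - (1 + h * w - h) *\<^sub>R T v)"
      by (simp add: c_def algebra_simps)
    also have "\<dots> = - (c *\<^sub>R (v - \<rho> *\<^sub>R T v))"
      using c by (simp add: \<rho>_def scaleR_diff_right)
    also have "\<dots> = y"
      unfolding v using c by simp
    finally show ?thesis
      unfolding D_def A_eq[symmetric] by blast
  qed
qed

text \<open>\<open>S\<close> is the contraction semigroup of \<open>A - w\<close>. The exponential
  factor undoes the shift and is the source of the quasicontractive bound.\<close>

definition R :: "real \<Rightarrow> 'a \<Rightarrow> 'a"
  where "R t x = exp (w * t) *\<^sub>R S t x"

lemma R_linear: "t \<ge> 0 \<Longrightarrow> bounded_linear (R t)"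
  unfolding R_def by (intro bounded_linear_compose[OF bounded_linear_scaleR_right] S_linear)

lemma R_commute:
  assumes "bounded_linear C" "\<And>x. C (T x) = T (C x)" "t \<ge> 0"
  shows "C (R t x) = R t (C x)"
proof -
  note lin = bounded_linear.linear[OF assms(1)]
  have "C (S t x) = S t (C x)"
    using A_commute[OF assms(1,2)]
    by (intro S_commute[OF assms(1) _ _ assms(3)]) (auto simp: linear_diff[OF lin] linear_scale[OF lin])
  then show ?thesis
    by (simp add: R_def linear_scale[OF lin])
qed

lemma R_T: "t \<ge> 0 \<Longrightarrow> T (R t x) = R t (T x)"
  by (rule R_commute[OF T_linear refl])

lemma R_clinear: "t \<ge> 0 \<Longrightarrow> bounded_clinear (R t)"
  unfolding bounded_clinear_def
  using R_linear R_commute[OF bounded_linear_scaleC, of _ t] T_scaleC by simp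

lemma R_0: "R 0 x = x"
  by (simp add: R_def S_0)

lemma norm_R_le: "t \<ge> 0 \<Longrightarrow> norm (R t x) \<le> exp (w * t) * norm x"
  by (simp add: R_def norm_S_le)

lemma R_add: "s \<ge> 0 \<Longrightarrow> t \<ge> 0 \<Longrightarrow> R (s + t) x = R s (R t x)"
  by (simp add: R_def S_add linear_scale[OF bounded_linear.linear[OF S_linear]] distrib_left exp_add)

lemma R_has_vector_derivative:
  assumes "x \<in> D" "t \<in> {0..b}"
  shows "((\<lambda>t. R t x) has_vector_derivative R t (A x)) (at t within {0..b})"
proof -
  have "((\<lambda>t. exp (w * t)) has_field_derivative exp (w * t) * w) (at t within {0..b})"
    by (auto intro!: derivative_eq_intros)
  from has_vector_derivative_scaleR[OF this S_has_vector_derivative[OF assms]]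
  have "((\<lambda>t. R t x) has_vector_derivative
      exp (w * t) *\<^sub>R S t (A x - w *\<^sub>R x) + (exp (w * t) * w) *\<^sub>R S t x) (at t within {0..b})"
    by (simp add: R_def)
  moreover have "S t (A x - w *\<^sub>R x) = S t (A x) - w *\<^sub>R S t x"
    using bounded_linear.linear[OF S_linear, of t] assms(2) by (simp add: linear_diff linear_scale)
  ultimately show ?thesis
    by (simp add: R_def scaleR_diff_right)
qed

lemma C0_semigroup_R: "C0_semigroup R"
proof -
  have "((\<lambda>t. R t x) \<longlongrightarrow> x) (at_right 0)" for x
  proof -
    have "((\<lambda>t. S t x) \<longlongrightarrow> S 0 x) (at 0 within {0..1})"
      using S_continuous[of 1 x] by (simp add: continuous_on_def)
    then have "((\<lambda>t. S t x) \<longlongrightarrow> S 0 x) (at_right 0)"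
      by (simp add: at_within_Icc_at_right)
    moreover have "((\<lambda>t. exp (w * t)) \<longlongrightarrow> exp (w * 0)) (at_right 0)"
      by (intro tendsto_intros)
    ultimately show ?thesis
      using tendsto_scaleR by (fastforce simp: R_def S_0)
  qed
  then show ?thesis
    unfolding C0_semigroup_def by (auto simp: R_clinear R_0 R_add fun_eq_iff)
qed

section \<open>Generator and cogenerator of \<open>R\<close>\<close>

lemma A_tendsto: "x \<in> D \<Longrightarrow> ((\<lambda>t. (R t x - x) /\<^sub>R t) \<longlongrightarrow> A x) (at_right 0)"
  using has_vector_derivative_imp_tendsto_at_right[OF R_has_vector_derivative[of x 0 1]]
  by (simp add: R_0)

lemma generator_R: "x \<in> D \<Longrightarrow> generator R x = A x"
  by (rule generator_eqI(2)) (rule A_tendsto)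

text \<open>\<open>A - (w + 1)\<close> is onto, and the generator, which extends \<open>A\<close>, inherits the growth bound
  of the semigroup and so has no eigenvalue \<open>w + 1\<close>; hence it does not properly extend \<open>A\<close>.\<close>

lemma generator_dom_R: "generator_dom R = D"
proof
  show "D \<subseteq> generator_dom R"
    by (intro subsetI generator_eqI(1)) (rule A_tendsto)
  show "generator_dom R \<subseteq> D"
  proof
    fix x assume x: "x \<in> generator_dom R"
    \<comment> \<open>\<open>x'\<close> is chosen so that \<open>A - (1 + w)\<close> takes at
      \<open>x'\<close> the value that the generator minus \<open>1 + w\<close> takes at
      \<open>x\<close>; the difference \<open>z\<close> is then annihilated by the generator minus
      \<open>1 + w\<close>.\<close>
    obtain x' where x': "x' \<in> D" "x' - 1 *\<^sub>R (A x' - w *\<^sub>R x') = (1 + w) *\<^sub>R x - generator R x"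
      using surj[of 1 "(1 + w) *\<^sub>R x - generator R x"] by auto
    define z where "z = x - x'"
    have "((\<lambda>t. (R t x - x) /\<^sub>R t - (R t x' - x') /\<^sub>R t) \<longlongrightarrow> generator R x - A x') (at_right 0)"
      by (intro tendsto_diff tendsto_generator x A_tendsto x')
    moreover have "generator R x - A x' = (1 + w) *\<^sub>R z"
      using x'(2) by (simp add: z_def algebra_simps)
    moreover have "\<forall>\<^sub>F t in at_right 0. (R t x - x) /\<^sub>R t - (R t x' - x') /\<^sub>R t = (R t z - z) /\<^sub>R t"
      using eventually_at_right_less[of "0::real"]
    proof eventually_elim
      case (elim t)
      then have "R t z = R t x - R t x'"
        unfolding z_def by (intro linear_diff bounded_linear.linear R_linear) simp
      then show ?case
        by (simp add: z_def flip: scaleR_diff_right)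
    qed
    ultimately have "((\<lambda>t. (R t z - z) /\<^sub>R t) \<longlongrightarrow> (1 + w) *\<^sub>R z) (at_right 0)"
      using Lim_transform_eventually by fastforce
    then have lim: "((\<lambda>t. inner ((R t z - z) /\<^sub>R t) z) \<longlongrightarrow> inner ((1 + w) *\<^sub>R z) z) (at_right 0)"
      by (rule tendsto_inner[OF _ tendsto_const])
    \<comment> \<open>The growth bound limits the right derivative of \<open><R t z, z>\<close> at 0
      by \<open>w |z|^2\<close>. That derivative equals \<open>(1 + w) |z|^2\<close>, so
      \<open>z = 0\<close>.\<close>
    have "((\<lambda>t. exp (w * t)) has_vector_derivative w) (at 0 within {0..1})"
      by (auto intro!: derivative_eq_intros simp flip: has_real_derivative_iff_has_vector_derivative)
    then have "((\<lambda>t. (exp (w * t) - exp (w * 0)) /\<^sub>R t * inner z z) \<longlongrightarrow> w * inner z z) (at_right 0)"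
      by (intro tendsto_mult_right has_vector_derivative_imp_tendsto_at_right)
    moreover have "\<forall>\<^sub>F t in at_right 0.
        inner ((R t z - z) /\<^sub>R t) z \<le> (exp (w * t) - exp (w * 0)) /\<^sub>R t * inner z z"
      using eventually_at_right_less[of "0::real"]
    proof eventually_elim
      case (elim t)
      have "inner (R t z) z \<le> norm (R t z) * norm z"
        by (rule norm_cauchy_schwarz)
      also have "\<dots> \<le> exp (w * t) * norm z * norm z"
        using elim by (intro mult_right_mono norm_R_le) auto
      also have "\<dots> = exp (w * t) * inner z z"
        by (simp add: power2_norm_eq_inner[symmetric] power2_eq_square)
      finally have "inner (R t z - z) z \<le> (exp (w * t) - exp (w * 0)) * inner z z"
        by (simp add: inner_diff_left algebra_simps)
      then show ?case
        using elim mult_left_mono[of _ _ "inverse t"] by (simp add: mult.assoc)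
    qed
    ultimately have "inner ((1 + w) *\<^sub>R z) z \<le> w * inner z z"
      using tendsto_le[OF trivial_limit_at_right_real _ lim] by blast
    then have "inner z z \<le> 0"
      by (simp add: algebra_simps)
    then have "z = 0"
      by (metis inner_gt_zero_iff not_less)
    then show "x \<in> D"
      using x' by (simp add: z_def)
  qed
qed

lemma is_cogenerator_R: "is_cogenerator T R"
proof -
  define Q where "Q x = generator R x - x" for x
  \<comment> \<open>\<open>A - I\<close> sends \<open>T v - v\<close> to
    \<open>(T v + v) - (T v - v) = 2 v\<close>, so its inverse is \<open>(T - I) / 2\<close>.
    Applying \<open>A + I\<close> to \<open>P y\<close> then returns \<open>T y\<close>.\<close>
  define P where "P y = T ((1/2) *\<^sub>R y) - (1/2) *\<^sub>R y" for y
  have PD: "P y \<in> D" for y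
    by (simp add: P_def D_def)
  have gP: "generator R (P y) = T ((1/2) *\<^sub>R y) + (1/2) *\<^sub>R y" for y
    unfolding generator_R[OF PD] unfolding P_def A_eq ..
  have QP: "Q (P y) = y" for y
    unfolding Q_def gP by (simp add: P_def flip: scaleR_left.add)
  have "P (Q x) = x" if x: "x \<in> D" for x
  proof -
    obtain v where v: "x = T v - v"
      using x by (auto simp: D_def)
    have "x = P (2 *\<^sub>R v)"
      by (simp add: v P_def)
    then show ?thesis
      using QP by simp
  qed
  then have bij: "bij_betw Q D UNIV"
    using PD QP by (intro bij_betwI[of _ _ _ P]) auto
  then have inv: "inv_into D Q = P"
    using QP PD by (intro ext inv_into_f_eq) (auto simp: bij_betw_def)
  have "bounded_linear P"
    unfolding P_def
    by (intro bounded_linear_sub bounded_linear_compose[OF T_linear] bounded_linear_scaleR_right)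
  moreover have "P (c *\<^sub>C x) = c *\<^sub>C P x" for c x
  proof -
    have "(1/2) *\<^sub>R c *\<^sub>C x = c *\<^sub>C (1/2) *\<^sub>R x"
      by (simp add: scaleR_eq_scaleC scaleC_scaleC mult.commute)
    then show ?thesis
      by (simp add: P_def T_scaleC linear_diff[OF bounded_linear.linear[OF bounded_linear_scaleC]])
  qed
  ultimately have "bounded_clinear P"
    by (simp add: bounded_clinear_def)
  then have "1 \<in> resolvent_set D (generator R)"
    using bij inv by (simp add: resolvent_set_def Q_def[abs_def])
  moreover have "cogenerator R y = T y" for y
  proof -
    have "cogenerator R y = generator R (P y) + P y"
      using inv by (simp add: cogenerator_def generator_dom_R Q_def[abs_def])
    also have "\<dots> = T y"
      unfolding gP by (simp add: P_def T_simps flip: scaleR_left.add)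
    finally show ?thesis .
  qed
  ultimately show ?thesis
    by (auto simp: is_cogenerator_def generator_dom_R)
qed

lemma two_isometry_R:
  assumes t: "t \<ge> 0"
  shows "two_isometry (R t)"
proof -
  define V where "V v = T v - v" for v
  have V: "bounded_linear V"
    unfolding V_def by (intro bounded_linear_sub T_linear bounded_linear_ident)
  have cont: "continuous_on UNIV (R t)"
    by (intro linear_continuous_on R_linear t)
  have "range (\<lambda>v. V (V v)) \<subseteq> {x. (norm (R t (R t x)))\<^sup>2 - 2 * (norm (R t x))\<^sup>2 + (norm x)\<^sup>2 = 0}"
  proof safe
    fix a
    \<comment> \<open>With \<open>V = T - I\<close>, this \<open>x\<close> lies in the domain of the
      square of \<open>A\<close>: \<open>A x = (T - I)(T + I) a\<close> and
      \<open>A (A x) = (T + I)^2 a\<close>, so the orbit of \<open>x\<close> is twice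
      differentiable.\<close>
    define x where "x = V (V a)"
    have x: "x \<in> D"
      by (simp add: x_def V_def D_def)
    have Ax: "A x = V (T a + a)"
      unfolding x_def V_def by (subst A_eq) (simp add: T_simps)
    then have Ax_D: "A x \<in> D"
      by (simp add: V_def D_def)
    have AAx: "A (A x) = T (T a + a) + (T a + a)"
      unfolding Ax V_def A_eq ..
    have "(norm (R (2 * t) x))\<^sup>2 - 2 * (norm (R t x))\<^sup>2 + (norm (R 0 x))\<^sup>2 = 0"
    proof (rule norm_power2_affine[OF R_has_vector_derivative[OF x] R_has_vector_derivative[OF Ax_D] _ t])
      fix s assume "s \<in> {0..2 * t}"
      then have s: "s \<ge> 0"
        by simp
      note lin = bounded_linear.linear[OF R_linear[OF s]]
      define c where "c = R s a"
      have "R s (T a) = T c" "R s (T (T a)) = T (T c)"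
        using R_T[OF s] by (simp_all add: c_def)
      note R_simps = this T_simps linear_add[OF lin] linear_diff[OF lin] c_def[symmetric]
      have eqs: "R s (A (A x)) = T (T c) + T c + (T c + c)" "R s (A x) = T (T c) - c"
        "R s x = T (T c) - T c - (T c - c)"
        unfolding AAx unfolding Ax unfolding x_def V_def by (simp_all add: R_simps)
      \<comment> \<open>With \<open>c = R s a\<close>, the sum of
        \<open><(T + I)^2 c, (T - I)^2 c>\<close> and \<open>|(T^2 - I) c|^2\<close> expands to
        twice this expression.\<close>
      have "inner (T (T c)) (T (T c)) - 2 * inner (T c) (T c) + inner c c = 0"
        using T unfolding two_isometry_def power2_norm_eq_inner by blast
      then show "inner (R s (A (A x))) (R s x) + inner (R s (A x)) (R s (A x)) = 0"
        unfolding eqs by (simp add: inner_add_left inner_add_right inner_diff_left inner_diff_right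
            inner_commute)
    qed simp_all
    then show "(norm (R t (R t (V (V a)))))\<^sup>2 - 2 * (norm (R t (V (V a))))\<^sup>2 + (norm (V (V a)))\<^sup>2 = 0"
      using R_add[OF t t, of x] by (simp add: x_def R_0)
  qed
  moreover have "closed {x. (norm (R t (R t x)))\<^sup>2 - 2 * (norm (R t x))\<^sup>2 + (norm x)\<^sup>2 = 0}"
    by (intro closed_Collect_eq continuous_intros continuous_on_compose2[OF cont] cont) auto
  ultimately have "closure (range (\<lambda>v. V (V v)))
      \<subseteq> {x. (norm (R t (R t x)))\<^sup>2 - 2 * (norm (R t x))\<^sup>2 + (norm x)\<^sup>2 = 0}"
    by (rule closure_minimal)
  \<comment> \<open>Density of the range of \<open>V^2\<close>: as \<open>closure D\<close> is the
    whole space, \<open>V\<close> maps it onto \<open>D\<close>, and continuity puts that image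
    inside the closure of the image of \<open>D\<close>. This closure therefore contains the dense
    set \<open>D\<close>.\<close>
  moreover have "D = V ` closure D"
    unfolding dense by (simp add: D_def V_def)
  then have "D \<subseteq> closure (V ` D)"
    using closure_bounded_linear_image_subset[OF V, of D] by simp
  then have "closure (V ` D) = UNIV"
    using closure_mono[of D "closure (V ` D)"] dense by auto
  moreover have "V ` D = range (\<lambda>v. V (V v))"
    by (auto simp: D_def V_def)
  ultimately show ?thesis
    using R_clinear[OF t] unfolding two_isometry_def by auto
qed

end

theorem theorem1p3:
  fixes T :: "'a::chilbert_space \<Rightarrow> 'a" and w :: real
  assumes "bounded_clinear T"
    and "two_isometry T"
    and "\<not> eigenvalue T 1"
    and "w \<ge> 0"
    and "\<And>x. (norm (T x))\<^sup>2 - (norm x)\<^sup>2 \<le> w * (norm (T x - x))\<^sup>2"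
  shows "\<exists>S. C0_semigroup S \<and> is_cogenerator T S \<and>
    two_isometric_semigroup S \<and> quasicontractive w S"
proof -
  interpret cogenerator_two_isometry T w
    using assms(2-5) by unfold_locales
  have "onorm (R t) \<le> exp (w * t)" if "t \<ge> 0" for t
    using that by (intro onorm_bound norm_R_le) auto
  then show ?thesis
    using C0_semigroup_R is_cogenerator_R two_isometry_R
    unfolding two_isometric_semigroup_def quasicontractive_def by blast
qed

end
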